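(* Let $\boldsymbol{x}_0\in\Omega$ and $f\in C^\alpha(\boldsymbol{x}_0)$, $\alpha\ge 0$. Assume that the samplets satisfy the vanishing moment condition $(\sigma_{j,k},p)_\Omega=0$ for all $p\in\mathcal{P}_q(\Omega)$ with some $q\ge\lfloor\alpha\rfloor$. Then, for every cluster $\tau$ that contains $\boldsymbol{x}_0$ (and the samplets $\sigma_{j,k}$ supported on $\tau$), there holds $$|(\sigma_{j,k},f)_\Omega|\lesssim \operatorname{diam}(\tau)^\alpha\sqrt{\#\tau}.$$ In particular, for $\Omega=[0,1]^d$ and balanced $2^d$-trees, there holds $$|(\sigma_{j,k},f)_\Omega|\lesssim \sqrt{N d^{\alpha}}\;2^{-j(\alpha+d/2)},$$ where $N$ is the number of data sites.
   Context: Notation. $\Omega\subset\mathbb{R}^d$ is a region. $A\lesssim B$ means that $A$ is bounded by a uniform constant times $B$, where the constant does not depend on any parameters which $A$ and $B$ might depend on; $A\sim B$ means $A\lesssim B$ and $B\lesssim A$. Microlocal space. For $\alpha\ge0$ and $\boldsymbol{x}_0\in\Omega$, a function $f\colon\Omega\to\mathbb{R}$ is in $C^\alpha(\boldsymbol{x}_0)$ if there exist a polynomial $P$ of degree $\lfloor\alpha\rfloor$ and a constant $R>0$ such that $|f(\boldsymbol{x})-P(\boldsymbol{x}-\boldsymbol{x}_0)|\lesssim\|\boldsymbol{x}-\boldsymbol{x}_0\|_2^\alpha$ for all $\boldsymbol{x}\in B_R(\boldsymbol{x}_0)=\{\boldsymbol{x}\in\mathbb{R}^d:\|\boldsymbol{x}-\boldsymbol{x}_0\|_2\le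 R\}$. Cluster trees. Let $X=\{\boldsymbol{x}_1,\dots,\boldsymbol{x}_N\}\subset\Omega$ be a set of $N$ data sites, assumed quasi-uniform (fill distance similar to separation radius). A cluster tree $\mathcal{T}$ for $X$ is a tree whose nodes (clusters) are subsets of $X$, whose root is $X$, and in which every non-leaf node is the disjoint union of its children. The level $j_\tau$ of $\tau$ is the number of edges from the root to $\tau$; the depth $J$ is the maximal level. $\#\tau$ is the cardinality of $\tau$ and $\operatorname{diam}(\tau)=\max_{\boldsymbol{x}_i,\boldsymbol{x}_j\in\tau}\|\boldsymbol{x}_i-\boldsymbol{x}_j\|_2$. A $2^d$-tree is a cluster tree of depth $J$ in which every cluster $\tau$ with $j_\tau<J$ has exactly $2^d$ children. It is balanced if $\#\tau\sim N2^{-j_\tau d}$. The $2^d$-tree is obtained by geometric clustering, i.e. recursive dyadic subdivision of the edges of the bounding box; for $\Omega=[0,1]^d$, a cluster on level $j$ is then contained in a dyadic cube of side length $2^{-j}$ (diameter $\sqrt d\,2^{-j}$). Samplets. For a functional $\sigma=\sum_{i=1}^N\omega_i\delta_{\boldsymbol{x}_i}$ put $(\sigma,f)_\Omega=\sum_{i=1}^N\omega_i f(\boldsymbol{x}_i)$. The span $\mathcal{X}'$ of $\delta_{\boldsymbol{x}_1},\dots,\delta_{\boldsymbol{x}_N}$ carries the inner product $\langle\sum u_i\delta_{\boldsymbol{x}_i},\sum v_i\delta_{\boldsymbol{x}_i}\rangle=\sum u_iv_i$. $\mathcal{P}_q(\Omega)$ denotes the polynomials of total degree at most $q$. Samplets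 are built recursively from the leaves to the root of $\mathcal{T}$: for a cluster $\tau$ on level $j$, one collects the scaling distributions $\boldsymbol{\Phi}^\tau_{j+1}$ of its children (for a leaf: the $\delta_{\boldsymbol{x}_i}$, $\boldsymbol{x}_i\in\tau$), takes the orthogonal factor $\boldsymbol{Q}^\tau_j=[\boldsymbol{Q}^\tau_{j,\Phi},\boldsymbol{Q}^\tau_{j,\Sigma}]$ of a QR decomposition of the transpose of the moment matrix $[(\boldsymbol{x}^{\boldsymbol{\beta}},\boldsymbol{\Phi}^\tau_{j+1})_\Omega]_{|\boldsymbol{\beta}|\le q}$, and sets $[\boldsymbol{\Phi}^\tau_j,\boldsymbol{\Sigma}^\tau_j]=\boldsymbol{\Phi}^\tau_{j+1}\boldsymbol{Q}^\tau_j$; the elements of $\boldsymbol{\Sigma}^\tau_j$ are the samplets $\sigma_{j,k}$ of $\tau$ (with $j$ the level and $k$ an index within the level), those of $\boldsymbol{\Phi}_j^\tau$ its scaling distributions. A samplet $\sigma_{j,k}$ supported on $\tau$ has the form $\sigma_{j,k}=\sum_{\boldsymbol{x}_\ell\in\tau}\omega^{(\ell)}_{j,k}\delta_{\boldsymbol{x}_\ell}$ with $\sum_\ell|\omega^{(\ell)}_{j,k}|^2=1$, and the samplets are orthonormal in $\mathcal{X}'$.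
   Formalization: The constant may depend on Ω, f, x0, α and on a bound M for |f| at the sites of τ outside a ball B_R(x0) given by f ∈ C^α(x0) (plus the balance constant in the second part); with a constant uniform in X and no such bound, the claim fails for unbounded f. *)

theory Defs
  imports "HOL-Analysis.Analysis"
begin

section \<open>Regions, polynomials and the microlocal space\<close>

text \<open>
  A region is a domain together with some, none or all of its boundary points, so that the closed
  unit cube is a region.
\<close>

definition region :: "(real ^ 'd) set \<Rightarrow> bool" where
  "region \<Omega> \<longleftrightarrow>
     (\<exists>U. open U \<and> connected U \<and> U \<noteq> {} \<and> U \<subseteq> \<Omega> \<and> \<Omega> \<subseteq> closure U)"

text \<open>Powers of a nonnegative base with \<open>0\<^sup>0 = 1\<close> (whereas \<open>0 powr 0 = 0\<close>).\<close>

definition rpow :: "real \<Rightarrow> real \<Rightarrow> real" where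
  "rpow t \<alpha> = (if \<alpha> = 0 then 1 else t powr \<alpha>)"

definition multi_indices :: "nat \<Rightarrow> ('d::finite \<Rightarrow> nat) set" where
  "multi_indices q = {\<beta>. (\<Sum>i\<in>UNIV. \<beta> i) \<le> q}"

definition monomial :: "('d::finite \<Rightarrow> nat) \<Rightarrow> real ^ 'd \<Rightarrow> real" where
  "monomial \<beta> x = (\<Prod>i\<in>UNIV. (x $ i) ^ \<beta> i)"

text \<open>Polynomial functions of total degree at most \<open>q\<close>.\<close>

definition polys :: "nat \<Rightarrow> (real ^ 'd \<Rightarrow> real) set" where
  "polys q = {p. \<exists>c. p = (\<lambda>x. \<Sum>\<beta>\<in>multi_indices q. c \<beta> * monomial \<beta> x)}"

text \<open>
  Functions on \<open>\<Omega>\<close> are represented by total functions, of which only the values on \<open>\<Omega>\<close> are used.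
\<close>

definition microlocal :: "(real ^ 'd) set \<Rightarrow> real \<Rightarrow> real ^ 'd \<Rightarrow> (real ^ 'd \<Rightarrow> real) set" where
  "microlocal \<Omega> \<alpha> x0 =
     {f. \<exists>P\<in>polys (nat \<lfloor>\<alpha>\<rfloor>). \<exists>R>0. \<exists>L. \<forall>x\<in>\<Omega> \<inter> cball x0 R.
           \<bar>f x - P (x - x0)\<bar> \<le> L * rpow (norm (x - x0)) \<alpha>}"

section \<open>Data sites\<close>

text \<open>
  Extended reals make the fill distance infinite if \<open>\<Omega>\<close> is not within bounded distance of the sites,
  and the separation radius infinite for a single site.
\<close>

definition fill_distance :: "(real ^ 'd) set \<Rightarrow> (real ^ 'd) set \<Rightarrow> ereal" where
  "fill_distance \<Omega> X = (SUP x\<in>\<Omega>. INF y\<in>X. ereal (dist x y))"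

definition separation_radius :: "(real ^ 'd) set \<Rightarrow> ereal" where
  "separation_radius X = (INF (x, y)\<in>{(x, y). x \<in> X \<and> y \<in> X \<and> x \<noteq> y}. ereal (dist x y / 2))"

definition quasi_uniform :: "real \<Rightarrow> (real ^ 'd) set \<Rightarrow> (real ^ 'd) set \<Rightarrow> bool" where
  "quasi_uniform c \<Omega> X \<longleftrightarrow>
     c > 0 \<and> fill_distance \<Omega> X \<le> ereal c * separation_radius X
           \<and> separation_radius X \<le> ereal c * fill_distance \<Omega> X"

section \<open>Cluster trees\<close>

datatype 'a ctree = Cluster (sites: "'a set") (kids: "'a ctree list")

primrec level_nodes :: "'a ctree \<Rightarrow> nat \<Rightarrow> 'a ctree set" where
  "level_nodes T 0 = {T}"
| "level_nodes T (Suc j) = (\<Union>t\<in>level_nodes T j. set (kids t))"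

definition nodes :: "'a ctree \<Rightarrow> 'a ctree set" where
  "nodes T = (\<Union>j. level_nodes T j)"

definition depth :: "'a ctree \<Rightarrow> nat" where
  "depth T = Max {j. level_nodes T j \<noteq> {}}"

definition cluster_tree :: "'a set \<Rightarrow> 'a ctree \<Rightarrow> bool" where
  "cluster_tree X T \<longleftrightarrow> sites T = X \<and>
     (\<forall>t\<in>nodes T. kids t \<noteq> [] \<longrightarrow>
        sites t = (\<Union>s\<in>set (kids t). sites s) \<and>
        (\<forall>i<length (kids t). \<forall>k<length (kids t).
           i \<noteq> k \<longrightarrow> sites (kids t ! i) \<inter> sites (kids t ! k) = {}))"

text \<open>In dimension \<open>d\<close> the following is used with \<open>m = 2 ^ d\<close>.\<close>

definition full_tree :: "nat \<Rightarrow> 'a ctree \<Rightarrow> bool" where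
  "full_tree m T \<longleftrightarrow> (\<forall>j<depth T. \<forall>t\<in>level_nodes T j. length (kids t) = m)"

text \<open>
  \<open>#\<tau> \<sim> N 2\<^sup>-\<^sup>j\<^sup>d\<close> with equivalence constant \<open>b\<close>, where \<open>N\<close> is the number of sites of the root.
\<close>

definition balanced :: "real \<Rightarrow> (real ^ 'd) ctree \<Rightarrow> bool" where
  "balanced b T \<longleftrightarrow> b > 0 \<and>
     (\<forall>j. \<forall>t\<in>level_nodes T j.
        real (card (sites t)) \<le> b * (real (card (sites T)) / 2 ^ (j * CARD('d))) \<and>
        real (card (sites T)) / 2 ^ (j * CARD('d)) \<le> b * real (card (sites t)))"

text \<open>
  Recursive dyadic subdivision of the box \<open>cbox l u\<close>. The subset \<open>E k\<close> of the coordinates consists of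
  those directions in which the \<open>k\<close>-th child takes the upper half of the edge; \<open>E\<close> enumerates all
  \<open>2\<^sup>d\<close> subsets. A site on a face shared by several boxes may be assigned to any one of them; that it
  is assigned only once is part of \<open>cluster_tree\<close>.
\<close>

inductive dyadic_clustering :: "real ^ 'd \<Rightarrow> real ^ 'd \<Rightarrow> (real ^ 'd) ctree \<Rightarrow> bool" where
  leaf: "A \<subseteq> cbox l u \<Longrightarrow> dyadic_clustering l u (Cluster A [])"
| split: "A \<subseteq> cbox l u \<Longrightarrow>
     bij_betw E {..<length ts} (UNIV :: 'd set set) \<Longrightarrow>
     (\<And>k. k < length ts \<Longrightarrow>
        dyadic_clustering
          (\<chi> i. if i \<in> E k then (l $ i + u $ i) / 2 else l $ i)
          (\<chi> i. if i \<in> E k then u $ i else (l $ i + u $ i) / 2) (ts ! k)) \<Longrightarrow>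
     dyadic_clustering l u (Cluster A ts)"

section \<open>Samplets\<close>

text \<open>
  The functional \<open>\<Sum>x\<in>X. \<omega> x \<cdot> \<delta>\<^sub>x\<close> is represented by its coefficient function \<open>\<omega>\<close>, which vanishes
  outside \<open>X\<close>. The inner product of the span of the point evaluations is then the Euclidean one of
  the coefficients.
\<close>

type_synonym 'd functional = "real ^ 'd \<Rightarrow> real"

definition dirac :: "real ^ 'd \<Rightarrow> 'd functional" where
  "dirac x = (\<lambda>y. of_bool (y = x))"

definition pairing :: "(real ^ 'd) set \<Rightarrow> 'd functional \<Rightarrow> (real ^ 'd \<Rightarrow> real) \<Rightarrow> real" where
  "pairing X \<sigma> f = (\<Sum>x\<in>X. \<sigma> x * f x)"

text \<open>
  Matrices of varying size are functions of two indices. \<open>qr_decomposition n m A Q R\<close>: the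
  \<open>n \<times> m\<close> matrix \<open>A\<close> equals \<open>Q R\<close> with \<open>Q\<close> orthogonal of size \<open>n\<close> and \<open>R\<close> upper triangular.
\<close>

definition qr_decomposition ::
  "nat \<Rightarrow> nat \<Rightarrow> (nat \<Rightarrow> nat \<Rightarrow> real) \<Rightarrow> (nat \<Rightarrow> nat \<Rightarrow> real) \<Rightarrow> (nat \<Rightarrow> nat \<Rightarrow> real) \<Rightarrow> bool" where
  "qr_decomposition n m A Q R \<longleftrightarrow>
     (\<forall>i<n. \<forall>k<n. (\<Sum>l<n. Q l i * Q l k) = of_bool (i = k)) \<and>
     (\<forall>i<n. \<forall>k<m. k < i \<longrightarrow> R i k = 0) \<and>
     (\<forall>i<n. \<forall>k<m. A i k = (\<Sum>l<n. Q i l * R l k))"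

text \<open>
  \<open>\<Phi> t\<close> and \<open>S t\<close> are the scaling distributions and the samplets of the node \<open>t\<close>. Two different
  nodes of a cluster tree can be equal as trees only if their clusters are empty, and then they carry
  no distributions; hence \<open>\<Phi>\<close> and \<open>S\<close> may be taken to depend on the subtree at the node.
  Since QR decompositions are not unique, \<open>samplets\<close> is a predicate. The order of the monomials and
  the column at which \<open>Q\<close> is divided into its scaling and samplet blocks are not prescribed; the
  latter is controlled by the vanishing moment condition.
\<close>

definition fine_basis ::
  "((real ^ 'd) ctree \<Rightarrow> 'd functional list) \<Rightarrow> (real ^ 'd) ctree \<Rightarrow> 'd functional list \<Rightarrow> bool" where
  "fine_basis \<Phi> t bs \<longleftrightarrow>
     (if kids t = [] then \<exists>xs. distinct xs \<and> set xs = sites t \<and> bs = map dirac xs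
      else bs = concat (map \<Phi> (kids t)))"

definition samplets ::
  "nat \<Rightarrow> (real ^ 'd) ctree \<Rightarrow> ((real ^ 'd) ctree \<Rightarrow> 'd functional list) \<Rightarrow>
   ((real ^ 'd) ctree \<Rightarrow> 'd functional list) \<Rightarrow> bool" where
  "samplets q T \<Phi> S \<longleftrightarrow>
     (\<forall>t\<in>nodes T. \<exists>bs \<beta>s Q R.
        fine_basis \<Phi> t bs \<and>
        distinct \<beta>s \<and> set \<beta>s = multi_indices q \<and>
        qr_decomposition (length bs) (length \<beta>s)
          (\<lambda>i k. pairing (sites T) (bs ! i) (monomial (\<beta>s ! k))) Q R \<and>
        \<Phi> t @ S t = map (\<lambda>k x. \<Sum>i<length bs. (bs ! i) x * Q i k) [0..<length bs])"

definition vanishing_moments ::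
  "nat \<Rightarrow> (real ^ 'd) ctree \<Rightarrow> ((real ^ 'd) ctree \<Rightarrow> 'd functional list) \<Rightarrow> bool" where
  "vanishing_moments q T S \<longleftrightarrow>
     (\<forall>t\<in>nodes T. \<forall>\<sigma>\<in>set (S t). \<forall>p\<in>polys q. pairing (sites T) \<sigma> p = 0)"

definition samplet_setting ::
  "(real ^ 'd) set \<Rightarrow> real \<Rightarrow> nat \<Rightarrow> (real ^ 'd) set \<Rightarrow> (real ^ 'd) ctree \<Rightarrow>
   ((real ^ 'd) ctree \<Rightarrow> 'd functional list) \<Rightarrow>
   ((real ^ 'd) ctree \<Rightarrow> 'd functional list) \<Rightarrow> bool" where
  "samplet_setting \<Omega> c q X T \<Phi> S \<longleftrightarrow>
     finite X \<and> X \<subseteq> \<Omega> \<and> quasi_uniform c \<Omega> X \<and>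
     cluster_tree X T \<and> samplets q T \<Phi> S \<and> vanishing_moments q T S"

end

theory Submission
  imports Defs
begin

text \<open>
  A samplet of a cluster \<open>\<tau>\<close> is a unit vector of coefficients supported on \<open>\<tau>\<close>, since passing from
  point evaluations to samplets only concatenates orthonormal systems with disjoint supports and
  applies orthogonal matrices (\<open>orthonormal_on_distributions\<close>). The moment conditions annihilate the
  Taylor polynomial \<open>P (x - x0)\<close> of \<open>f\<close> at \<open>x0\<close>, because polynomial spaces are translation invariant
  (\<open>polys_translate\<close>). Only the Taylor remainder is seen by the samplet, and Cauchy--Schwarz
  (\<open>abs_pairing_le\<close>) bounds the coefficient by the maximum of the remainder on \<open>\<tau>\<close> times \<open>sqrt (#\<tau>)\<close>.

  If \<open>\<tau>\<close> contains \<open>x0\<close>, all its points are within \<open>diam \<tau>\<close> of \<open>x0\<close>. Near \<open>x0\<close> the remainder is of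
  order \<open>|x - x0| powr \<alpha>\<close> by definition of the microlocal space. At distance more than \<open>R\<close> from \<open>x0\<close>
  the same order holds once \<open>f\<close> is bounded by \<open>M\<close> at the sites there: \<open>M\<close> and all powers of
  \<open>|x - x0|\<close> of order at most \<open>\<alpha>\<close> are dominated by a multiple of \<open>|x - x0| powr \<alpha>\<close>
  (\<open>microlocal_remainder_bound\<close>). The resulting constant depends on \<open>f\<close>, \<open>x0\<close>, \<open>\<alpha>\<close>, \<open>R\<close> and \<open>M\<close>, but
  not on the sites, the tree or the samplets.

  On the unit cube, a dyadic cluster of level \<open>j\<close> lies in a cube of side \<open>2\<^sup>-\<^sup>j\<close>, hence has diameter at
  most \<open>sqrt d / 2\<^sup>j\<close>, and balance gives \<open>#\<tau> \<le> b N / 2\<^sup>j\<^sup>d\<close>. Substituting both yields the second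
  estimate (\<open>dyadic_cluster_bound\<close>).
\<close>

section \<open>Polynomial functions\<close>

lemma finite_multi_indices: "finite (multi_indices q :: ('d::finite \<Rightarrow> nat) set)"
proof (rule finite_subset)
  show "multi_indices q \<subseteq> (UNIV :: 'd set) \<rightarrow>\<^sub>E {..q}"
  proof
    fix \<beta> :: "'d \<Rightarrow> nat" assume "\<beta> \<in> multi_indices q"
    then have "\<beta> i \<le> q" for i
      using member_le_sum[of i UNIV \<beta>] by (simp add: multi_indices_def)
    then show "\<beta> \<in> UNIV \<rightarrow>\<^sub>E {..q}" by auto
  qed
qed (simp add: finite_PiE)

lemma polysI: "p = (\<lambda>x. \<Sum>\<beta>\<in>multi_indices q. c \<beta> * monomial \<beta> x) \<Longrightarrow> p \<in> polys q"
  unfolding polys_def mem_Collect_eq by (rule exI[of _ c])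

lemma polys_mono: "m \<le> n \<Longrightarrow> polys m \<subseteq> polys n"
proof
  fix p :: "real ^ 'd \<Rightarrow> real" assume "m \<le> n" "p \<in> polys m"
  then obtain c where p: "p = (\<lambda>x. \<Sum>\<beta>\<in>multi_indices m. c \<beta> * monomial \<beta> x)"
    by (auto simp: polys_def)
  have "p = (\<lambda>x. \<Sum>\<beta>\<in>multi_indices n. (if \<beta> \<in> multi_indices m then c \<beta> else 0) * monomial \<beta> x)"
    unfolding p using \<open>m \<le> n\<close>
    by (intro ext sum.mono_neutral_cong_left[OF finite_multi_indices])
      (auto simp: multi_indices_def)
  then show "p \<in> polys n" by (rule polysI)
qed

lemma polys_monomial: "(\<Sum>i\<in>UNIV. \<beta> i) \<le> q \<Longrightarrow> monomial \<beta> \<in> polys q"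
proof -
  assume "(\<Sum>i\<in>UNIV. \<beta> i) \<le> q"
  then have "\<beta> \<in> multi_indices q" by (simp add: multi_indices_def)
  then have "monomial \<beta> = (\<lambda>x. \<Sum>\<gamma>\<in>multi_indices q. of_bool (\<gamma> = \<beta>) * monomial \<gamma> x)"
    by (simp add: finite_multi_indices)
  then show ?thesis by (rule polysI)
qed

lemma polys_0: "(\<lambda>x. 0) \<in> polys q"
  by (rule polysI[of _ "\<lambda>_. 0"]) simp

lemma polys_add:
  assumes "p \<in> polys q" "r \<in> polys q"
  shows "(\<lambda>x. p x + r x) \<in> polys q"
proof -
  obtain c d where "p = (\<lambda>x. \<Sum>\<beta>\<in>multi_indices q. c \<beta> * monomial \<beta> x)"
    "r = (\<lambda>x. \<Sum>\<beta>\<in>multi_indices q. d \<beta> * monomial \<beta> x)"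
    using assms by (auto simp: polys_def)
  then have "(\<lambda>x. p x + r x) = (\<lambda>x. \<Sum>\<beta>\<in>multi_indices q. (c \<beta> + d \<beta>) * monomial \<beta> x)"
    by (simp add: sum.distrib distrib_right)
  then show ?thesis by (rule polysI)
qed

lemma polys_scale:
  assumes "p \<in> polys q"
  shows "(\<lambda>x. a * p x) \<in> polys q"
proof -
  obtain c where "p = (\<lambda>x. \<Sum>\<beta>\<in>multi_indices q. c \<beta> * monomial \<beta> x)"
    using assms by (auto simp: polys_def)
  then have "(\<lambda>x. a * p x) = (\<lambda>x. \<Sum>\<beta>\<in>multi_indices q. (a * c \<beta>) * monomial \<beta> x)"
    by (simp add: sum_distrib_left mult.assoc)
  then show ?thesis by (rule polysI)
qed

lemma polys_sum:
  assumes "\<And>i. i \<in> I \<Longrightarrow> p i \<in> polys q"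
  shows "(\<lambda>x. \<Sum>i\<in>I. p i x) \<in> polys q"
  using assms by (induction I rule: infinite_finite_induct) (auto intro: polys_0 polys_add)

lemma polys_mult:
  assumes "p \<in> polys m" "r \<in> polys n"
  shows "(\<lambda>x. p x * r x) \<in> polys (m + n)"
proof -
  obtain c d where p: "p = (\<lambda>x. \<Sum>\<beta>\<in>multi_indices m. c \<beta> * monomial \<beta> x)"
    and r: "r = (\<lambda>x. \<Sum>\<beta>\<in>multi_indices n. d \<beta> * monomial \<beta> x)"
    using assms by (auto simp: polys_def)
  have "p x * r x = (\<Sum>\<beta>\<in>multi_indices m. \<Sum>\<gamma>\<in>multi_indices n.
      (c \<beta> * d \<gamma>) * monomial (\<lambda>i. \<beta> i + \<gamma> i) x)" for x
    unfolding p r sum_product monomial_def power_add prod.distrib by (simp add: mult_ac)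
  moreover have "(\<lambda>x. \<Sum>\<beta>\<in>multi_indices m. \<Sum>\<gamma>\<in>multi_indices n.
      (c \<beta> * d \<gamma>) * monomial (\<lambda>i. \<beta> i + \<gamma> i) x) \<in> polys (m + n)"
    by (intro polys_sum polys_scale polys_monomial)
      (simp add: multi_indices_def sum.distrib add_mono)
  ultimately show ?thesis by simp
qed

lemma polys_1: "(\<lambda>x. 1) \<in> polys q"
  using polys_monomial[of "\<lambda>_. 0" q] by (simp add: monomial_def[abs_def])

lemma polys_power:
  assumes "p \<in> polys m"
  shows "(\<lambda>x. p x ^ k) \<in> polys (k * m)"
  using assms by (induction k) (auto intro: polys_1 polys_mult)

lemma polys_prod:
  assumes "finite I" "\<And>i. i \<in> I \<Longrightarrow> p i \<in> polys (m i)"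
  shows "(\<lambda>x. \<Prod>i\<in>I. p i x) \<in> polys (\<Sum>i\<in>I. m i)"
  using assms by (induction I) (auto intro: polys_1 polys_mult)

lemma polys_coordinate: "(\<lambda>x. x $ i) \<in> polys 1"
proof -
  have "monomial (\<lambda>k. of_bool (k = i)) = (\<lambda>x::real ^ 'a. x $ i)"
    unfolding monomial_def
    by (rule ext, subst prod.remove[of _ i]) (auto intro!: prod.neutral)
  moreover have "monomial (\<lambda>k. of_bool (k = i)) \<in> polys 1"
    by (rule polys_monomial) simp
  ultimately show ?thesis by simp
qed

text \<open>
  Vanishing moments are stated for polynomials centred at the origin, whereas the Taylor polynomial
  of a microlocal function is centred at the point under consideration. Translation only expands
  every factor of a monomial without raising its degree.
\<close>

lemma polys_translate:
  assumes "p \<in> polys q"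
  shows "(\<lambda>x. p (x - a)) \<in> polys q"
proof -
  obtain c where p: "p = (\<lambda>x. \<Sum>\<beta>\<in>multi_indices q. c \<beta> * monomial \<beta> x)"
    using assms by (auto simp: polys_def)
  have "(\<lambda>x. monomial \<beta> (x - a)) \<in> polys q" if "\<beta> \<in> multi_indices q" for \<beta>
  proof -
    have "(\<lambda>x. x $ i + (- a $ i) * 1) \<in> polys 1" for i
      by (intro polys_add polys_coordinate polys_scale polys_1)
    then have "(\<lambda>x. (x $ i + (- a $ i) * 1) ^ \<beta> i) \<in> polys (\<beta> i * 1)" for i
      by (rule polys_power)
    then have "(\<lambda>x. \<Prod>i\<in>UNIV. (x $ i + (- a $ i) * 1) ^ \<beta> i) \<in> polys (\<Sum>i\<in>UNIV. \<beta> i * 1)"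
      by (intro polys_prod) auto
    then show ?thesis
      using that polys_mono[of "\<Sum>i\<in>UNIV. \<beta> i" q] by (auto simp: monomial_def multi_indices_def)
  qed
  then show ?thesis unfolding p by (intro polys_sum polys_scale)
qed

section \<open>Growth of polynomials and microlocal functions\<close>

lemma rpow_nonneg: "rpow t \<alpha> \<ge> 0"
  by (simp add: rpow_def)

lemma rpow_pos: "t > 0 \<Longrightarrow> rpow t \<alpha> > 0"
  by (simp add: rpow_def)

lemma rpow_mono: "0 \<le> s \<Longrightarrow> s \<le> t \<Longrightarrow> \<alpha> \<ge> 0 \<Longrightarrow> rpow s \<alpha> \<le> rpow t \<alpha>"
  by (auto simp: rpow_def intro: powr_mono2)

lemma abs_monomial_le: "\<bar>monomial \<beta> y\<bar> \<le> norm y ^ (\<Sum>i\<in>UNIV. \<beta> i)"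
proof -
  have "\<bar>monomial \<beta> y\<bar> = (\<Prod>i\<in>UNIV. \<bar>y $ i\<bar> ^ \<beta> i)"
    by (simp add: monomial_def abs_prod power_abs)
  also have "\<dots> \<le> (\<Prod>i\<in>UNIV. norm y ^ \<beta> i)"
    by (intro prod_mono) (auto intro: power_mono component_le_norm_cart)
  finally show ?thesis by (simp add: power_sum)
qed

text \<open>
  Away from the origin every power of order at most \<open>\<alpha>\<close> is dominated by the power of order \<open>\<alpha>\<close>.
  This makes the bound uniform over unbounded regions.
\<close>

lemma polys_bound_outside_ball:
  assumes "R > 0" "\<alpha> \<ge> 0" "P \<in> polys (nat \<lfloor>\<alpha>\<rfloor>)"
  obtains K where "K \<ge> 0" "\<And>y. norm y \<ge> R \<Longrightarrow> \<bar>P y\<bar> \<le> K * rpow (norm y) \<alpha>"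
proof -
  let ?I = "multi_indices (nat \<lfloor>\<alpha>\<rfloor>) :: ('a \<Rightarrow> nat) set"
  define deg where "deg \<beta> = (\<Sum>i\<in>UNIV. \<beta> i)" for \<beta> :: "'a \<Rightarrow> nat"
  obtain c where P: "P = (\<lambda>x. \<Sum>\<beta>\<in>?I. c \<beta> * monomial \<beta> x)"
    using assms by (auto simp: polys_def)
  define K where "K = (\<Sum>\<beta>\<in>?I. \<bar>c \<beta>\<bar> * R powr (real (deg \<beta>) - \<alpha>))"
  have "\<bar>P y\<bar> \<le> K * rpow (norm y) \<alpha>" if y: "norm y \<ge> R" for y
  proof -
    have y0: "norm y > 0" using y assms by linarith
    have "\<bar>monomial \<beta> y\<bar> \<le> R powr (real (deg \<beta>) - \<alpha>) * norm y powr \<alpha>" if "\<beta> \<in> ?I" for \<beta>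
    proof -
      have "real (deg \<beta>) \<le> \<alpha>"
        using that \<open>\<alpha> \<ge> 0\<close> unfolding multi_indices_def deg_def mem_Collect_eq by linarith
      then have "norm y powr (real (deg \<beta>) - \<alpha>) \<le> R powr (real (deg \<beta>) - \<alpha>)"
        using y assms by (intro powr_mono2') auto
      moreover have "norm y ^ deg \<beta> = norm y powr (real (deg \<beta>) - \<alpha>) * norm y powr \<alpha>"
        using y0 by (simp add: powr_add[symmetric] powr_realpow)
      ultimately show ?thesis
        using abs_monomial_le[of \<beta> y] mult_right_mono[of _ _ "norm y powr \<alpha>"]
        unfolding deg_def by fastforce
    qed
    then have "\<bar>P y\<bar> \<le> (\<Sum>\<beta>\<in>?I. \<bar>c \<beta>\<bar> * (R powr (real (deg \<beta>) - \<alpha>) * norm y powr \<alpha>))"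
      unfolding P by (intro sum_abs[THEN order_trans] sum_mono) (simp add: abs_mult mult_left_mono)
    moreover have "rpow (norm y) \<alpha> = norm y powr \<alpha>" using y0 by (simp add: rpow_def)
    ultimately show ?thesis
      by (simp only: K_def sum_distrib_right mult.assoc)
  qed
  moreover have "K \<ge> 0" unfolding K_def by (intro sum_nonneg) simp
  ultimately show thesis using that by blast
qed

text \<open>
  Outside the ball of radius \<open>R\<close> the distance to \<open>x0\<close> is bounded below, so that a bound \<open>M\<close> for
  \<open>f\<close> and the growth of the Taylor polynomial are both absorbed into the power of the distance.
\<close>

lemma microlocal_remainder_bound:
  assumes "\<alpha> \<ge> 0" "f \<in> microlocal \<Omega> \<alpha> x0"
  obtains P R where "P \<in> polys (nat \<lfloor>\<alpha>\<rfloor>)" "R > 0"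
    "\<And>M. \<exists>C>0. \<forall>x\<in>\<Omega>. (x \<notin> cball x0 R \<longrightarrow> \<bar>f x\<bar> \<le> M) \<longrightarrow>
       \<bar>f x - P (x - x0)\<bar> \<le> C * rpow (norm (x - x0)) \<alpha>"
proof -
  obtain P R L where P: "P \<in> polys (nat \<lfloor>\<alpha>\<rfloor>)" and R: "R > 0"
    and L: "\<And>x. x \<in> \<Omega> \<inter> cball x0 R \<Longrightarrow> \<bar>f x - P (x - x0)\<bar> \<le> L * rpow (norm (x - x0)) \<alpha>"
    using assms(2) unfolding microlocal_def by blast
  obtain K where K: "K \<ge> 0" "\<And>y. norm y \<ge> R \<Longrightarrow> \<bar>P y\<bar> \<le> K * rpow (norm y) \<alpha>"
    using polys_bound_outside_ball[OF R assms(1) P] by blast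
  have "\<exists>C>0. \<forall>x\<in>\<Omega>. (x \<notin> cball x0 R \<longrightarrow> \<bar>f x\<bar> \<le> M) \<longrightarrow>
       \<bar>f x - P (x - x0)\<bar> \<le> C * rpow (norm (x - x0)) \<alpha>" for M
  proof (intro exI conjI ballI impI)
    define D where "D = \<bar>M\<bar> / rpow R \<alpha>"
    have D: "D \<ge> 0" by (simp add: D_def rpow_nonneg)
    then show "\<bar>L\<bar> + D + K + 1 > 0" using K(1) by linarith
    fix x assume x: "x \<in> \<Omega>" and M: "x \<notin> cball x0 R \<longrightarrow> \<bar>f x\<bar> \<le> M"
    let ?r = "rpow (norm (x - x0)) \<alpha>"
    show "\<bar>f x - P (x - x0)\<bar> \<le> (\<bar>L\<bar> + D + K + 1) * ?r"
    proof (cases "x \<in> cball x0 R")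
      case True
      have "L * ?r \<le> (\<bar>L\<bar> + D + K + 1) * ?r"
        by (rule mult_right_mono) (use D K(1) in \<open>auto simp: rpow_nonneg\<close>)
      then show ?thesis using L[of x] x True by force
    next
      case False
      then have far: "norm (x - x0) \<ge> R" by (simp add: dist_norm norm_minus_commute)
      have "M \<le> D * rpow R \<alpha>" using rpow_pos[OF R, of \<alpha>] by (simp add: D_def)
      also have "\<dots> \<le> D * ?r"
        using far R D assms(1) by (intro mult_left_mono rpow_mono) auto
      finally have "\<bar>f x - P (x - x0)\<bar> \<le> D * ?r + K * ?r"
        using M False K(2)[OF far] by force
      also have "\<dots> = (D + K) * ?r" by (simp add: algebra_simps)
      also have "\<dots> \<le> (\<bar>L\<bar> + D + K + 1) * ?r"
        by (rule mult_right_mono) (auto simp: rpow_nonneg)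
      finally show ?thesis .
    qed
  qed
  then show thesis using that P R by blast
qed

section \<open>Orthonormality of samplets\<close>

text \<open>
  Since a functional is represented by its coefficients, the pairing of two functionals is their
  inner product.
\<close>

definition orthonormal_on ::
  "(real ^ 'd) set \<Rightarrow> (real ^ 'd) set \<Rightarrow> 'd functional list \<Rightarrow> bool" where
  "orthonormal_on X A bs \<longleftrightarrow>
     (\<forall>u\<in>set bs. (\<forall>x. x \<notin> A \<longrightarrow> u x = 0) \<and> pairing X u u = 1) \<and>
     sorted_wrt (\<lambda>u v. pairing X u v = 0) bs"

lemma pairing_commute: "pairing X u v = pairing X v u"
  by (simp add: pairing_def mult.commute)

lemma orthonormal_on_nth:
  assumes "orthonormal_on X A bs" "i < length bs" "k < length bs"
  shows "pairing X (bs ! i) (bs ! k) = of_bool (i = k)"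
proof (cases i k rule: linorder_cases)
  case greater
  then have "pairing X (bs ! k) (bs ! i) = 0"
    using assms by (auto simp: orthonormal_on_def sorted_wrt_iff_nth_less)
  then show ?thesis using greater by (simp add: pairing_commute)
qed (use assms in \<open>auto simp: orthonormal_on_def sorted_wrt_iff_nth_less\<close>)

lemma orthonormal_on_append:
  assumes "orthonormal_on X A bs" "orthonormal_on X B cs" "A \<inter> B = {}"
  shows "orthonormal_on X (A \<union> B) (bs @ cs)"
proof -
  have "pairing X u v = 0" if "u \<in> set bs" "v \<in> set cs" for u v
    unfolding pairing_def
  proof (intro sum.neutral ballI)
    fix x
    have "u x = 0 \<or> v x = 0" using that assms unfolding orthonormal_on_def by blast
    then show "u x * v x = 0" by simp
  qed
  then show ?thesis using assms by (auto simp: orthonormal_on_def sorted_wrt_append)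
qed

lemma orthonormal_on_concat:
  assumes "\<And>t. t \<in> set ts \<Longrightarrow> orthonormal_on X (A t) (\<Phi> t)"
    and "sorted_wrt (\<lambda>s t. A s \<inter> A t = {}) ts"
  shows "orthonormal_on X (\<Union>t\<in>set ts. A t) (concat (map \<Phi> ts))"
  using assms
proof (induction ts)
  case Nil
  then show ?case by (simp add: orthonormal_on_def)
next
  case (Cons t ts)
  then have "orthonormal_on X (A t \<union> (\<Union>s\<in>set ts. A s)) (\<Phi> t @ concat (map \<Phi> ts))"
    by (intro orthonormal_on_append) auto
  then show ?case by simp
qed

lemma orthonormal_on_dirac:
  assumes "finite X" "set xs \<subseteq> X" "distinct xs"
  shows "orthonormal_on X (set xs) (map dirac xs)"
proof -
  have dirac_pairing: "pairing X (dirac x) (dirac y) = of_bool (x = y)" if "x \<in> X" for x y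
    using that assms(1) by (simp add: pairing_def dirac_def)
  have "xs ! i \<in> X" if "i < length xs" for i
    using assms(2) that nth_mem by blast
  then have "sorted_wrt (\<lambda>x y. pairing X (dirac x) (dirac y) = 0) xs"
    using assms(3) by (auto simp: sorted_wrt_iff_nth_less dirac_pairing nth_eq_iff_index_eq)
  then show ?thesis
    using assms(2) dirac_pairing
    by (auto simp: orthonormal_on_def sorted_wrt_map dirac_def subset_eq)
qed

text \<open>A change of basis by a matrix with orthonormal columns is an isometry.\<close>

lemma orthonormal_on_transform:
  assumes on: "orthonormal_on X A bs"
    and Q: "\<And>i k. i < length bs \<Longrightarrow> k < length bs \<Longrightarrow>
      (\<Sum>l<length bs. Q l i * Q l k) = of_bool (i = k)"
  shows "orthonormal_on X A (map (\<lambda>k x. \<Sum>i<length bs. (bs ! i) x * Q i k) [0..<length bs])"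
    (is "orthonormal_on X A (map ?c _)")
proof -
  let ?n = "length bs"
  have ip: "pairing X (?c k) (?c m) = of_bool (k = m)" if "k < ?n" "m < ?n" for k m
  proof -
    have "pairing X (?c k) (?c m) =
        (\<Sum>x\<in>X. \<Sum>i<?n. \<Sum>l<?n. Q i k * Q l m * ((bs ! i) x * (bs ! l) x))"
      unfolding pairing_def sum_product by (simp add: mult_ac)
    also have "\<dots> = (\<Sum>i<?n. \<Sum>l<?n. Q i k * Q l m * pairing X (bs ! i) (bs ! l))"
      unfolding pairing_def sum_distrib_left
      by (subst sum.swap) (intro sum.cong refl sum.swap)
    also have "\<dots> = (\<Sum>i<?n. \<Sum>l<?n. if l = i then Q i k * Q l m else 0)"
      by (intro sum.cong refl) (auto simp: orthonormal_on_nth[OF on])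
    also have "\<dots> = (\<Sum>i<?n. Q i k * Q i m)"
      by (intro sum.cong refl) simp
    finally show ?thesis using Q that by simp
  qed
  have "?c k x = 0" if "x \<notin> A" for k x
    using that on by (intro sum.neutral) (auto simp: orthonormal_on_def)
  then show ?thesis
    using ip by (auto simp: orthonormal_on_def sorted_wrt_iff_nth_less)
qed

lemma kids_in_nodes: "t \<in> nodes T \<Longrightarrow> s \<in> set (kids t) \<Longrightarrow> s \<in> nodes T"
proof -
  assume "t \<in> nodes T" "s \<in> set (kids t)"
  then obtain j where "s \<in> level_nodes T (Suc j)" unfolding nodes_def by auto
  then show ?thesis unfolding nodes_def by blast
qed

lemma sites_subset_root:
  assumes "cluster_tree X T" "t \<in> nodes T"
  shows "sites t \<subseteq> X"
proof -
  have "sites s \<subseteq> X" if "s \<in> level_nodes T j" for s j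
    using that
  proof (induction j arbitrary: s)
    case 0
    then show ?case using assms(1) by (simp add: cluster_tree_def)
  next
    case (Suc j)
    then obtain r where r: "r \<in> level_nodes T j" "s \<in> set (kids r)" by auto
    then have "r \<in> nodes T" "kids r \<noteq> []" unfolding nodes_def by auto
    then have "sites r = (\<Union>s\<in>set (kids r). sites s)"
      using assms(1) unfolding cluster_tree_def by blast
    then show ?case using Suc.IH[OF r(1)] r(2) by blast
  qed
  then show ?thesis using assms(2) unfolding nodes_def by blast
qed

text \<open>
  The recursion runs from the leaves to the root: point evaluations at distinct sites are orthonormal,
  siblings carry functionals with disjoint supports, and the orthogonal factor preserves
  orthonormality.
\<close>

lemma orthonormal_on_distributions:
  assumes X: "finite X" and T: "cluster_tree X T" and sam: "samplets q T \<Phi> S"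
    and t: "t \<in> nodes T"
  shows "orthonormal_on X (sites t) (\<Phi> t @ S t)"
  using t
proof (induction t)
  case (Cluster A ts)
  let ?t = "Cluster A ts"
  obtain bs \<beta>s Q R where fb: "fine_basis \<Phi> ?t bs"
    and qr: "qr_decomposition (length bs) (length \<beta>s)
          (\<lambda>i k. pairing (sites T) (bs ! i) (monomial (\<beta>s ! k))) Q R"
    and eq: "\<Phi> ?t @ S ?t = map (\<lambda>k x. \<Sum>i<length bs. (bs ! i) x * Q i k) [0..<length bs]"
    using bspec[OF sam[unfolded samplets_def] Cluster.prems] by blast
  have "orthonormal_on X (sites ?t) bs"
  proof (cases "ts = []")
    case True
    then obtain xs where "distinct xs" "set xs = sites ?t" "bs = map dirac xs"
      using fb by (auto simp: fine_basis_def)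
    then show ?thesis
      using orthonormal_on_dirac[OF X, of xs] sites_subset_root[OF T Cluster.prems] by simp
  next
    case False
    then have bs: "bs = concat (map \<Phi> ts)" using fb by (simp add: fine_basis_def)
    have "kids ?t \<noteq> []" using False by simp
    then have split: "sites ?t = (\<Union>s\<in>set (kids ?t). sites s) \<and>
        (\<forall>i<length (kids ?t). \<forall>k<length (kids ?t).
           i \<noteq> k \<longrightarrow> sites (kids ?t ! i) \<inter> sites (kids ?t ! k) = {})"
      using T Cluster.prems unfolding cluster_tree_def by blast
    then have un: "sites ?t = (\<Union>s\<in>set ts. sites s)" by simp
    have dj: "sorted_wrt (\<lambda>s s'. sites s \<inter> sites s' = {}) ts"
      using split by (auto simp: sorted_wrt_iff_nth_less)
    have "orthonormal_on X (sites s) (\<Phi> s)" if "s \<in> set ts" for s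
      using Cluster.IH[OF that] kids_in_nodes[OF Cluster.prems] that
      by (auto simp: orthonormal_on_def sorted_wrt_append)
    then show ?thesis unfolding bs un by (rule orthonormal_on_concat[OF _ dj])
  qed
  then show ?case
    unfolding eq using qr by (intro orthonormal_on_transform) (auto simp: qr_decomposition_def)
qed

section \<open>Decay of the samplet coefficients\<close>

text \<open>Cauchy--Schwarz on the support of the functional.\<close>

lemma abs_pairing_le:
  assumes "finite X" "A \<subseteq> X" "\<And>x. x \<notin> A \<Longrightarrow> \<sigma> x = 0" "pairing X \<sigma> \<sigma> = 1"
    and "B \<ge> 0" "\<And>x. x \<in> A \<Longrightarrow> \<bar>g x\<bar> \<le> B"
  shows "\<bar>pairing X \<sigma> g\<bar> \<le> B * sqrt (real (card A))"
proof -
  have A: "finite A" using assms finite_subset by blast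
  have restrict: "pairing X \<sigma> h = (\<Sum>x\<in>A. \<sigma> x * h x)" for h
    unfolding pairing_def using assms by (intro sum.mono_neutral_right) auto
  have "\<bar>pairing X \<sigma> g\<bar> \<le> (\<Sum>x\<in>A. \<bar>\<sigma> x\<bar> * \<bar>g x\<bar>)"
    unfolding restrict by (rule order_trans[OF sum_abs]) (simp add: abs_mult)
  also have "\<dots> \<le> L2_set \<sigma> A * L2_set g A" by (rule L2_set_mult_ineq)
  also have "L2_set \<sigma> A = 1"
    using assms(4) unfolding restrict by (simp add: L2_set_def power2_eq_square)
  also have "L2_set g A = L2_set (\<lambda>x. \<bar>g x\<bar>) A" by (simp add: L2_set_def)
  also have "\<dots> \<le> L2_set (\<lambda>x. B) A" using assms by (intro L2_set_mono) auto
  also have "\<dots> = B * sqrt (real (card A))"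
    using \<open>B \<ge> 0\<close> by (simp add: L2_set_def real_sqrt_mult)
  finally show ?thesis by simp
qed

text \<open>
  The moment condition allows the Taylor polynomial at \<open>x0\<close> to be subtracted from \<open>f\<close>; as \<open>x0\<close>
  belongs to the cluster, the remainder is controlled by the diameter.
\<close>

lemma abs_samplet_coefficient_le:
  assumes set: "samplet_setting \<Omega> c q X T \<Phi> S" and q: "nat \<lfloor>\<alpha>\<rfloor> \<le> q" and "\<alpha> \<ge> 0"
    and P: "P \<in> polys (nat \<lfloor>\<alpha>\<rfloor>)" and "C > 0"
    and t: "t \<in> nodes T" "x0 \<in> sites t" and \<sigma>: "\<sigma> \<in> set (S t)"
    and rem: "\<And>x. x \<in> sites t \<Longrightarrow> \<bar>f x - P (x - x0)\<bar> \<le> C * rpow (norm (x - x0)) \<alpha>"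
  shows "\<bar>pairing X \<sigma> f\<bar> \<le> C * (rpow (diameter (sites t)) \<alpha> * sqrt (real (card (sites t))))"
proof -
  have X: "finite X" and T: "cluster_tree X T" and sam: "samplets q T \<Phi> S"
    and vm: "vanishing_moments q T S"
    using set by (auto simp: samplet_setting_def)
  have XT: "sites T = X" using T by (simp add: cluster_tree_def)
  have sub: "sites t \<subseteq> X" by (rule sites_subset_root[OF T t(1)])
  let ?p = "\<lambda>x. P (x - x0)"
  have "?p \<in> polys q"
    using polys_translate[OF P] polys_mono[OF q] by blast
  then have "pairing X \<sigma> ?p = 0"
    using vm t(1) \<sigma> unfolding vanishing_moments_def XT by blast
  then have "pairing X \<sigma> f = pairing X \<sigma> (\<lambda>x. f x - ?p x)"
    by (simp add: pairing_def right_diff_distrib sum_subtractf)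
  also have "\<bar>\<dots>\<bar> \<le> C * rpow (diameter (sites t)) \<alpha> * sqrt (real (card (sites t)))"
  proof (rule abs_pairing_le[OF X sub])
    show "\<sigma> x = 0" if "x \<notin> sites t" for x
      using orthonormal_on_distributions[OF X T sam t(1)] \<sigma> that
      by (auto simp: orthonormal_on_def)
    show "pairing X \<sigma> \<sigma> = 1"
      using orthonormal_on_distributions[OF X T sam t(1)] \<sigma>
      by (auto simp: orthonormal_on_def)
    show "C * rpow (diameter (sites t)) \<alpha> \<ge> 0" using \<open>C > 0\<close> by (simp add: rpow_nonneg)
    fix x assume x: "x \<in> sites t"
    have "bounded (sites t)" using X sub finite_subset finite_imp_bounded by blast
    then have "norm (x - x0) \<le> diameter (sites t)"
      using diameter_bounded_bound[of "sites t" x x0] x t(2) by (simp add: dist_norm)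
    then have "C * rpow (norm (x - x0)) \<alpha> \<le> C * rpow (diameter (sites t)) \<alpha>"
      using \<open>C > 0\<close> \<open>\<alpha> \<ge> 0\<close> by (intro mult_left_mono rpow_mono) auto
    then show "\<bar>f x - ?p x\<bar> \<le> C * rpow (diameter (sites t)) \<alpha>"
      using rem[OF x] by linarith
  qed
  finally show ?thesis by (simp add: mult.assoc)
qed

section \<open>Dyadic clusters\<close>

lemma dyadic_clustering_subset: "dyadic_clustering l u t \<Longrightarrow> sites t \<subseteq> cbox l u"
  by (cases rule: dyadic_clustering.cases) auto

lemma dyadic_clustering_level:
  assumes "dyadic_clustering l u T" "t \<in> level_nodes T j"
  shows "\<exists>l' u'. dyadic_clustering l' u' t \<and> (\<forall>i. u' $ i - l' $ i = (u $ i - l $ i) / 2 ^ j)"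
  using assms(2)
proof (induction j arbitrary: t)
  case 0
  then show ?case using assms(1) by auto
next
  case (Suc j)
  then obtain r where r: "r \<in> level_nodes T j" "t \<in> set (kids r)" by auto
  obtain l' u' where d: "dyadic_clustering l' u' r"
    and e: "\<And>i. u' $ i - l' $ i = (u $ i - l $ i) / 2 ^ j"
    using Suc.IH[OF r(1)] by blast
  from d show ?case
  proof (cases rule: dyadic_clustering.cases)
    case (leaf A)
    then show ?thesis using r(2) by simp
  next
    case (split A E ts)
    then obtain k where k: "k < length ts" "t = ts ! k"
      using r(2) by (auto simp: in_set_conv_nth)
    let ?l = "\<chi> i. if i \<in> E k then (l' $ i + u' $ i) / 2 else l' $ i"
    let ?u = "\<chi> i. if i \<in> E k then u' $ i else (l' $ i + u' $ i) / 2"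
    have "?u $ i - ?l $ i = (u' $ i - l' $ i) / 2" for i by (simp add: field_simps)
    then have "\<forall>i. ?u $ i - ?l $ i = (u $ i - l $ i) / 2 ^ Suc j" using e by simp
    then show ?thesis using split(4)[OF k(1)] k(2) by blast
  qed
qed

lemma diameter_dyadic_cluster_le:
  fixes T :: "(real ^ 'd) ctree"
  assumes "dyadic_clustering 0 (\<chi> i. 1) T" "t \<in> level_nodes T j"
  shows "diameter (sites t) \<le> sqrt (real CARD('d)) / 2 ^ j"
proof -
  obtain l u :: "real ^ 'd" where d: "dyadic_clustering l u t"
    and side: "\<And>i. u $ i - l $ i = 1 / 2 ^ j"
    using dyadic_clustering_level[OF assms] by auto
  have "norm (x - y) \<le> sqrt (real CARD('d)) / 2 ^ j" if "x \<in> sites t" "y \<in> sites t" for x y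
  proof -
    have "x \<in> cbox l u" "y \<in> cbox l u" using dyadic_clustering_subset[OF d] that by auto
    then have "\<bar>(x - y) $ i\<bar> \<le> 1 / 2 ^ j" for i
      using side[of i] unfolding mem_box_cart abs_le_iff vector_minus_component by (smt (verit))
    then have "norm (x - y) \<le> L2_set (\<lambda>i::'d. 1 / 2 ^ j) UNIV"
      unfolding norm_vec_def by (intro L2_set_mono) auto
    also have "\<dots> = sqrt (real CARD('d)) / 2 ^ j"
      by (simp add: L2_set_def real_sqrt_mult real_sqrt_divide)
    finally show ?thesis .
  qed
  then show ?thesis by (intro diameter_le) auto
qed

text \<open>
  Balance turns \<open>#\<tau>\<close> into \<open>N 2\<^sup>-\<^sup>j\<^sup>d\<close>, whose square root supplies the factor \<open>2 powr (- j d / 2)\<close>;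
  the remaining decay comes from the side length of the dyadic cube.
\<close>

lemma dyadic_cluster_bound:
  fixes T :: "(real ^ 'd) ctree"
  assumes "dyadic_clustering 0 (\<chi> i. 1) T" "balanced b T" "t \<in> level_nodes T j" "\<alpha> \<ge> 0"
    and "finite (sites t)"
  shows "rpow (diameter (sites t)) \<alpha> * sqrt (real (card (sites t))) \<le>
     sqrt b * (sqrt (real (card (sites T)) * real CARD('d) powr \<alpha>)
       * 2 powr (- real j * (\<alpha> + real CARD('d) / 2)))"
proof -
  let ?d = "real CARD('d)" and ?N = "real (card (sites T))"
  have "rpow (diameter (sites t)) \<alpha> \<le> rpow (sqrt ?d / 2 ^ j) \<alpha>"
    using diameter_dyadic_cluster_le[OF assms(1,3)] assms(4,5)
    by (intro rpow_mono) (auto intro: diameter_ge_0 finite_imp_bounded)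
  also have "\<dots> = (sqrt ?d / 2 ^ j) powr \<alpha>" by (simp add: rpow_def)
  also have "\<dots> = sqrt (?d powr \<alpha>) * 2 powr (- real j * \<alpha>)"
  proof -
    have "sqrt ?d powr \<alpha> = sqrt (?d powr \<alpha>)"
      by (simp add: powr_half_sqrt[symmetric] powr_powr mult.commute)
    moreover have "(2 ^ j) powr \<alpha> = 2 powr (real j * \<alpha>)"
      by (simp add: powr_realpow[symmetric] powr_powr)
    moreover have "(sqrt ?d / 2 ^ j) powr \<alpha> = sqrt ?d powr \<alpha> / (2 ^ j) powr \<alpha>"
      by (rule powr_divide)
    ultimately show ?thesis by (simp add: powr_minus divide_inverse)
  qed
  finally have diam: "rpow (diameter (sites t)) \<alpha> \<le> sqrt (?d powr \<alpha>) * 2 powr (- real j * \<alpha>)" .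
  have "real (card (sites t)) \<le> b * (?N / 2 ^ (j * CARD('d)))"
    using assms(2,3) by (auto simp: balanced_def)
  then have "sqrt (real (card (sites t))) \<le> sqrt (b * (?N / 2 ^ (j * CARD('d))))"
    by simp
  also have "\<dots> = sqrt b * sqrt ?N * 2 powr (- real j * (?d / 2))"
  proof -
    have "sqrt (2 ^ (j * CARD('d))) = (2 powr real (j * CARD('d))) powr (1/2)"
      by (simp only: powr_realpow[of 2, simplified]) (simp add: powr_half_sqrt)
    also have "\<dots> = 2 powr (real j * (?d / 2))" by (simp add: powr_powr)
    finally have root: "sqrt (2 ^ (j * CARD('d))) = 2 powr (real j * (?d / 2))" .
    show ?thesis
      unfolding real_sqrt_mult real_sqrt_divide root mult_minus_left powr_minus_divide
      by simp
  qed
  finally have card: "sqrt (real (card (sites t))) \<le> sqrt b * sqrt ?N * 2 powr (- real j * (?d / 2))" .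
  have "rpow (diameter (sites t)) \<alpha> * sqrt (real (card (sites t))) \<le>
      (sqrt (?d powr \<alpha>) * 2 powr (- real j * \<alpha>)) * (sqrt b * sqrt ?N * 2 powr (- real j * (?d / 2)))"
    by (intro mult_mono diam card) auto
  also have "\<dots> = sqrt b * (sqrt (?N * ?d powr \<alpha>) * 2 powr (- real j * (\<alpha> + ?d / 2)))"
    by (simp only: real_sqrt_mult distrib_left powr_add mult_ac)
  finally show ?thesis .
qed

section \<open>The coefficient estimate\<close>

theorem theorem3p1:
  fixes \<Omega> :: "(real ^ 'd) set" and x0 :: "real ^ 'd"
    and f :: "real ^ 'd \<Rightarrow> real" and \<alpha> :: real
  assumes "region \<Omega>" and "x0 \<in> \<Omega>" and "\<alpha> \<ge> 0" and "f \<in> microlocal \<Omega> \<alpha> x0"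
  shows "\<exists>R>0. \<forall>M. \<exists>C>0.
    (\<forall>c q X T \<Phi> S.
       samplet_setting \<Omega> c q X T \<Phi> S \<and> q \<ge> nat \<lfloor>\<alpha>\<rfloor> \<longrightarrow>
       (\<forall>t\<in>nodes T. x0 \<in> sites t \<and> (\<forall>x\<in>sites t - cball x0 R. \<bar>f x\<bar> \<le> M) \<longrightarrow>
          (\<forall>\<sigma>\<in>set (S t).
             \<bar>pairing X \<sigma> f\<bar> \<le> C * (rpow (diameter (sites t)) \<alpha> * sqrt (real (card (sites t))))))) \<and>
    (\<Omega> = cbox 0 (\<chi> i. 1) \<longrightarrow>
     (\<forall>c q X T \<Phi> S b.
        samplet_setting \<Omega> c q X T \<Phi> S \<and> q \<ge> nat \<lfloor>\<alpha>\<rfloor> \<and>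
        full_tree (2 ^ CARD('d)) T \<and> dyadic_clustering 0 (\<chi> i. 1) T \<and> balanced b T \<longrightarrow>
        (\<forall>j. \<forall>t\<in>level_nodes T j.
           x0 \<in> sites t \<and> (\<forall>x\<in>sites t - cball x0 R. \<bar>f x\<bar> \<le> M) \<longrightarrow>
           (\<forall>\<sigma>\<in>set (S t).
              \<bar>pairing X \<sigma> f\<bar> \<le> C * sqrt b *
                (sqrt (real (card X) * real CARD('d) powr \<alpha>)
                 * 2 powr (- real j * (\<alpha> + real CARD('d) / 2)))))))"
proof -
  obtain P R where P: "P \<in> polys (nat \<lfloor>\<alpha>\<rfloor>)" and R: "R > 0"
    and rem: "\<And>M. \<exists>C>0. \<forall>x\<in>\<Omega>. (x \<notin> cball x0 R \<longrightarrow> \<bar>f x\<bar> \<le> M) \<longrightarrow>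
       \<bar>f x - P (x - x0)\<bar> \<le> C * rpow (norm (x - x0)) \<alpha>"
    using microlocal_remainder_bound[OF assms(3,4)] by metis
  show ?thesis
  proof (rule exI[of _ R], intro conjI R allI)
    fix M
    obtain C where C: "C > 0" and bd: "\<And>x. x \<in> \<Omega> \<Longrightarrow> (x \<notin> cball x0 R \<Longrightarrow> \<bar>f x\<bar> \<le> M) \<Longrightarrow>
       \<bar>f x - P (x - x0)\<bar> \<le> C * rpow (norm (x - x0)) \<alpha>"
      using rem[of M] by blast
    have main: "\<bar>pairing X \<sigma> f\<bar> \<le> C * (rpow (diameter (sites t)) \<alpha> * sqrt (real (card (sites t))))"
      if "samplet_setting \<Omega> c q X T \<Phi> S" "nat \<lfloor>\<alpha>\<rfloor> \<le> q" "t \<in> nodes T" "x0 \<in> sites t"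
        "\<forall>x\<in>sites t - cball x0 R. \<bar>f x\<bar> \<le> M" "\<sigma> \<in> set (S t)" for c q X T \<Phi> S t \<sigma>
    proof (rule abs_samplet_coefficient_le[OF that(1,2) assms(3) P C that(3,4,6)])
      fix x assume x: "x \<in> sites t"
      have "sites t \<subseteq> X" "X \<subseteq> \<Omega>"
        using that(1,3) sites_subset_root by (auto simp: samplet_setting_def)
      then show "\<bar>f x - P (x - x0)\<bar> \<le> C * rpow (norm (x - x0)) \<alpha>"
        using bd[of x] that(5) x by blast
    qed
    have dyadic: "\<bar>pairing X \<sigma> f\<bar> \<le> C * sqrt b *
                (sqrt (real (card X) * real CARD('d) powr \<alpha>)
                 * 2 powr (- real j * (\<alpha> + real CARD('d) / 2)))"
      if "samplet_setting \<Omega> c q X T \<Phi> S" "nat \<lfloor>\<alpha>\<rfloor> \<le> q"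
        "dyadic_clustering 0 (\<chi> i. 1) T" "balanced b T" "t \<in> level_nodes T j" "x0 \<in> sites t"
        "\<forall>x\<in>sites t - cball x0 R. \<bar>f x\<bar> \<le> M" "\<sigma> \<in> set (S t)" for c q X T \<Phi> S b j t \<sigma>
    proof -
      have t: "t \<in> nodes T" using that(5) unfolding nodes_def by blast
      have X: "finite X" "sites T = X" "cluster_tree X T"
        using that(1) by (auto simp: samplet_setting_def cluster_tree_def)
      have "finite (sites t)" using X(1) sites_subset_root[OF X(3) t] finite_subset by blast
      from dyadic_cluster_bound[OF that(3-5) assms(3) this] C
        main[OF that(1,2) t that(6-8)] show ?thesis
        unfolding X(2) mult.assoc by (meson less_imp_le mult_left_mono order_trans)
    qed
    show "\<exists>C>0.
    (\<forall>c q X T \<Phi> S.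
       samplet_setting \<Omega> c q X T \<Phi> S \<and> q \<ge> nat \<lfloor>\<alpha>\<rfloor> \<longrightarrow>
       (\<forall>t\<in>nodes T. x0 \<in> sites t \<and> (\<forall>x\<in>sites t - cball x0 R. \<bar>f x\<bar> \<le> M) \<longrightarrow>
          (\<forall>\<sigma>\<in>set (S t).
             \<bar>pairing X \<sigma> f\<bar> \<le> C * (rpow (diameter (sites t)) \<alpha> * sqrt (real (card (sites t))))))) \<and>
    (\<Omega> = cbox 0 (\<chi> i. 1) \<longrightarrow>
     (\<forall>c q X T \<Phi> S b.
        samplet_setting \<Omega> c q X T \<Phi> S \<and> q \<ge> nat \<lfloor>\<alpha>\<rfloor> \<and>
        full_tree (2 ^ CARD('d)) T \<and> dyadic_clustering 0 (\<chi> i. 1) T \<and> balanced b T \<longrightarrow>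
        (\<forall>j. \<forall>t\<in>level_nodes T j.
           x0 \<in> sites t \<and> (\<forall>x\<in>sites t - cball x0 R. \<bar>f x\<bar> \<le> M) \<longrightarrow>
           (\<forall>\<sigma>\<in>set (S t).
              \<bar>pairing X \<sigma> f\<bar> \<le> C * sqrt b *
                (sqrt (real (card X) * real CARD('d) powr \<alpha>)
                 * 2 powr (- real j * (\<alpha> + real CARD('d) / 2)))))))"
    proof (intro exI[of _ C] conjI C allI impI ballI; (elim conjE)?)
    qed (rule main dyadic; assumption)+
  qed
qed

end
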